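(* Let $\mathbb{C}$ be a comonad on a category $\mathcal{C}$ with products (indexed by a set $I$), where $\mathcal{C}$ carries a proper factorisation system $(\mathcal{E},\mathcal{M})$ and $\mathbb{C}$ preserves embeddings, such that $\mathrm{EM}(\mathbb{C})$, with the lifted factorisation system and a chosen class of paths, is a path category. If $\mathrm{EM}(\mathbb{C})$ has equalisers and paths are closed under quotients, then for all families $\{A_i\}_{i\in I}$, $\{B_i\}_{i\in I}$ of objects of $\mathcal{C}$: if $A_i\equiv_{\mathbb{C}}B_i$ for all $i\in I$, then $\prod_iA_i\equiv_{\mathbb{C}}\prod_iB_i$.
   Context: Comonad $(\mathbb{C},\varepsilon,\delta)$; $\mathbb{C}$-coalgebras $(A,\alpha)$ ($\varepsilon_A\circ\alpha=\mathrm{id}$, $\delta_A\circ\alpha=\mathbb{C}(\alpha)\circ\alpha$); coalgebra morphisms; category $\mathrm{EM}(\mathbb{C})$; cofree coalgebra $F^{\mathbb{C}}(A)=(\mathbb{C}A,\delta_A)$. A proper factorisation system: every morphism factors as $m\circ e$, $e\in\mathcal{E}$, $m\in\mathcal{M}$, the classes are each other's weak-orthogonality classes (diagonal fillers), $\mathcal{E}$ epis, $\mathcal{M}$ monos; members of $\mathcal{E}$ are quotients, of $\mathcal{M}$ embeddings. $\mathbb{C}$ preserves embeddings if $\mathbb{C}(m)$ is an embedding for every embedding $m$; then in the lifted factorisation system on $\mathrm{EM}(\mathbb{C})$ a coalgebra morphism is a quotient/embedding iff its underlying morphism is. A path category is a category with a proper factorisation system and a chosen class of objects called paths. Paths are closed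 under quotients if for any quotient $X\twoheadrightarrow Y$ with $X$ a path, $Y$ is a path. Path embedding: embedding with path domain. $f\colon X\to Y$ is a pathwise-embedding if $f\circ e$ is an embedding for all path embeddings $e$ into $X$; open if for all commuting squares $f\circ e=m\circ g$ of path embeddings $e\colon P\rightarrowtail X$, $g\colon P\rightarrowtail Q$, $m\colon Q\rightarrowtail Y$ there is $d\colon Q\to X$ with $d\circ g=e$, $f\circ d=m$. $A\equiv_{\mathbb{C}}B$ means there is a span $F^{\mathbb{C}}(A)\leftarrow Z\rightarrow F^{\mathbb{C}}(B)$ of open pathwise-embeddings in $\mathrm{EM}(\mathbb{C})$. *)

theory Defs
  imports Main
begin

section \<open>Categories\<close>

text \<open>Composition is in applicative order: \<open>g \<odot>\<^bsub>C\<^esub> f\<close> is \<open>g\<close> after \<open>f\<close>. It is only meaningful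
  when \<open>Dom C g = Cod C f\<close>.\<close>

record ('o, 'a) cat =
  Obj :: "'o set"
  Arr :: "'a set"
  Dom :: "'a \<Rightarrow> 'o"
  Cod :: "'a \<Rightarrow> 'o"
  Ident :: "'o \<Rightarrow> 'a"
  Comp :: "'a \<Rightarrow> 'a \<Rightarrow> 'a" (infixr "\<odot>\<index>" 70)

definition Hom :: "('o, 'a, 'z) cat_scheme \<Rightarrow> 'o \<Rightarrow> 'o \<Rightarrow> 'a set" where
  "Hom C X Y = {f \<in> Arr C. Dom C f = X \<and> Cod C f = Y}"

locale category =
  fixes C :: "('o, 'a, 'z) cat_scheme" (structure)
  assumes Dom_Obj: "f \<in> Arr C \<Longrightarrow> Dom C f \<in> Obj C"
    and Cod_Obj: "f \<in> Arr C \<Longrightarrow> Cod C f \<in> Obj C"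
    and Ident_Hom: "X \<in> Obj C \<Longrightarrow> Ident C X \<in> Hom C X X"
    and Comp_Hom: "\<lbrakk>f \<in> Hom C X Y; g \<in> Hom C Y Z\<rbrakk> \<Longrightarrow> g \<odot> f \<in> Hom C X Z"
    and Comp_Ident: "f \<in> Hom C X Y \<Longrightarrow> f \<odot> Ident C X = f"
    and Ident_Comp: "f \<in> Hom C X Y \<Longrightarrow> Ident C Y \<odot> f = f"
    and Comp_assoc: "\<lbrakk>f \<in> Hom C W X; g \<in> Hom C X Y; h \<in> Hom C Y Z\<rbrakk>
      \<Longrightarrow> (h \<odot> g) \<odot> f = h \<odot> (g \<odot> f)"

definition mono_arr :: "('o, 'a, 'z) cat_scheme \<Rightarrow> 'a \<Rightarrow> bool" where
  "mono_arr C m \<longleftrightarrow> m \<in> Arr C \<and>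
    (\<forall>X. \<forall>f\<in>Hom C X (Dom C m). \<forall>g\<in>Hom C X (Dom C m). m \<odot>\<^bsub>C\<^esub> f = m \<odot>\<^bsub>C\<^esub> g \<longrightarrow> f = g)"

definition epi_arr :: "('o, 'a, 'z) cat_scheme \<Rightarrow> 'a \<Rightarrow> bool" where
  "epi_arr C e \<longleftrightarrow> e \<in> Arr C \<and>
    (\<forall>Y. \<forall>f\<in>Hom C (Cod C e) Y. \<forall>g\<in>Hom C (Cod C e) Y. f \<odot>\<^bsub>C\<^esub> e = g \<odot>\<^bsub>C\<^esub> e \<longrightarrow> f = g)"

definition is_product ::
    "('o, 'a, 'z) cat_scheme \<Rightarrow> 'i set \<Rightarrow> ('i \<Rightarrow> 'o) \<Rightarrow> 'o \<Rightarrow> ('i \<Rightarrow> 'a) \<Rightarrow> bool" where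
  "is_product C I A P \<pi> \<longleftrightarrow>
    P \<in> Obj C \<and> (\<forall>i\<in>I. \<pi> i \<in> Hom C P (A i)) \<and>
    (\<forall>X\<in>Obj C. \<forall>f. (\<forall>i\<in>I. f i \<in> Hom C X (A i)) \<longrightarrow>
      (\<exists>!h. h \<in> Hom C X P \<and> (\<forall>i\<in>I. \<pi> i \<odot>\<^bsub>C\<^esub> h = f i)))"

definition has_products :: "('o, 'a, 'z) cat_scheme \<Rightarrow> 'i set \<Rightarrow> bool" where
  "has_products C I \<longleftrightarrow>
    (\<forall>A. (\<forall>i\<in>I. A i \<in> Obj C) \<longrightarrow> (\<exists>P \<pi>. is_product C I A P \<pi>))"

definition is_equaliser :: "('o, 'a, 'z) cat_scheme \<Rightarrow> 'a \<Rightarrow> 'a \<Rightarrow> 'a \<Rightarrow> bool" where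
  "is_equaliser C f g k \<longleftrightarrow>
    k \<in> Arr C \<and> Cod C k = Dom C f \<and> f \<odot>\<^bsub>C\<^esub> k = g \<odot>\<^bsub>C\<^esub> k \<and>
    (\<forall>X. \<forall>h\<in>Hom C X (Dom C f). f \<odot>\<^bsub>C\<^esub> h = g \<odot>\<^bsub>C\<^esub> h \<longrightarrow>
      (\<exists>!u. u \<in> Hom C X (Dom C k) \<and> k \<odot>\<^bsub>C\<^esub> u = h))"

definition has_equalisers :: "('o, 'a, 'z) cat_scheme \<Rightarrow> bool" where
  "has_equalisers C \<longleftrightarrow>
    (\<forall>X Y. \<forall>f\<in>Hom C X Y. \<forall>g\<in>Hom C X Y. \<exists>k. is_equaliser C f g k)"


section \<open>Proper factorisation systems and path categories\<close>

text \<open>Weak orthogonality: every commuting square with \<open>e\<close> on the left and \<open>m\<close> on the right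
  has a (not necessarily unique) diagonal filler.\<close>

definition weakly_orthogonal :: "('o, 'a, 'z) cat_scheme \<Rightarrow> 'a \<Rightarrow> 'a \<Rightarrow> bool" where
  "weakly_orthogonal C e m \<longleftrightarrow>
    (\<forall>u\<in>Hom C (Dom C e) (Dom C m). \<forall>v\<in>Hom C (Cod C e) (Cod C m).
      v \<odot>\<^bsub>C\<^esub> e = m \<odot>\<^bsub>C\<^esub> u \<longrightarrow>
      (\<exists>d\<in>Hom C (Cod C e) (Dom C m). d \<odot>\<^bsub>C\<^esub> e = u \<and> m \<odot>\<^bsub>C\<^esub> d = v))"

locale proper_factorisation_system = category C
  for C :: "('o, 'a, 'z) cat_scheme" (structure) +
  fixes E M :: "'a set"
  assumes factorisation: "f \<in> Hom C X Y \<Longrightarrow>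
      \<exists>W. \<exists>e \<in> Hom C X W. \<exists>m \<in> Hom C W Y. e \<in> E \<and> m \<in> M \<and> f = m \<odot> e"
    and E_eq: "E = {e \<in> Arr C. \<forall>m\<in>M. weakly_orthogonal C e m}"
    and M_eq: "M = {m \<in> Arr C. \<forall>e\<in>E. weakly_orthogonal C e m}"
    and E_epi: "e \<in> E \<Longrightarrow> epi_arr C e"
    and M_mono: "m \<in> M \<Longrightarrow> mono_arr C m"

locale path_category = proper_factorisation_system C E M
  for C :: "('o, 'a, 'z) cat_scheme" (structure) and E M :: "'a set" +
  fixes Paths :: "'o set"
  assumes Paths_Obj: "Paths \<subseteq> Obj C"

definition closed_under_quotients ::
    "('o, 'a, 'z) cat_scheme \<Rightarrow> 'a set \<Rightarrow> 'o set \<Rightarrow> bool" where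
  "closed_under_quotients C E Paths \<longleftrightarrow>
    (\<forall>q\<in>E. Dom C q \<in> Paths \<longrightarrow> Cod C q \<in> Paths)"

definition path_embedding ::
    "('o, 'a, 'z) cat_scheme \<Rightarrow> 'a set \<Rightarrow> 'o set \<Rightarrow> 'a \<Rightarrow> bool" where
  "path_embedding C M Paths e \<longleftrightarrow> e \<in> M \<and> Dom C e \<in> Paths"

definition pathwise_embedding ::
    "('o, 'a, 'z) cat_scheme \<Rightarrow> 'a set \<Rightarrow> 'o set \<Rightarrow> 'a \<Rightarrow> bool" where
  "pathwise_embedding C M Paths f \<longleftrightarrow> f \<in> Arr C \<and>
    (\<forall>e. path_embedding C M Paths e \<and> Cod C e = Dom C f \<longrightarrow> f \<odot>\<^bsub>C\<^esub> e \<in> M)"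

definition open_arr ::
    "('o, 'a, 'z) cat_scheme \<Rightarrow> 'a set \<Rightarrow> 'o set \<Rightarrow> 'a \<Rightarrow> bool" where
  "open_arr C M Paths f \<longleftrightarrow> f \<in> Arr C \<and>
    (\<forall>P Q. \<forall>e\<in>Hom C P (Dom C f). \<forall>g\<in>Hom C P Q. \<forall>m\<in>Hom C Q (Cod C f).
      path_embedding C M Paths e \<and> path_embedding C M Paths g \<and> path_embedding C M Paths m \<and>
      f \<odot>\<^bsub>C\<^esub> e = m \<odot>\<^bsub>C\<^esub> g \<longrightarrow>
      (\<exists>d\<in>Hom C Q (Dom C f). d \<odot>\<^bsub>C\<^esub> g = e \<and> f \<odot>\<^bsub>C\<^esub> d = m))"


section \<open>Comonads and coalgebras\<close>

record ('o, 'a) comonad_data =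
  omap :: "'o \<Rightarrow> 'o"
  amap :: "'a \<Rightarrow> 'a"
  counit :: "'o \<Rightarrow> 'a"
  comult :: "'o \<Rightarrow> 'a"

locale comonad = category C
  for C :: "('o, 'a, 'z) cat_scheme" (structure) +
  fixes T :: "('o, 'a, 'y) comonad_data_scheme"
  assumes omap_Obj: "X \<in> Obj C \<Longrightarrow> omap T X \<in> Obj C"
    and amap_Hom: "f \<in> Hom C X Y \<Longrightarrow> amap T f \<in> Hom C (omap T X) (omap T Y)"
    and amap_Ident: "X \<in> Obj C \<Longrightarrow> amap T (Ident C X) = Ident C (omap T X)"
    and amap_Comp: "\<lbrakk>f \<in> Hom C X Y; g \<in> Hom C Y Z\<rbrakk>
      \<Longrightarrow> amap T (g \<odot> f) = amap T g \<odot> amap T f"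
    and counit_Hom: "X \<in> Obj C \<Longrightarrow> counit T X \<in> Hom C (omap T X) X"
    and comult_Hom: "X \<in> Obj C \<Longrightarrow> comult T X \<in> Hom C (omap T X) (omap T (omap T X))"
    and counit_natural: "f \<in> Hom C X Y \<Longrightarrow> counit T Y \<odot> amap T f = f \<odot> counit T X"
    and comult_natural: "f \<in> Hom C X Y \<Longrightarrow>
      comult T Y \<odot> amap T f = amap T (amap T f) \<odot> comult T X"
    and counit_comult: "X \<in> Obj C \<Longrightarrow>
      counit T (omap T X) \<odot> comult T X = Ident C (omap T X)"
    and amap_counit_comult: "X \<in> Obj C \<Longrightarrow>
      amap T (counit T X) \<odot> comult T X = Ident C (omap T X)"
    and comult_coassoc: "X \<in> Obj C \<Longrightarrow>
      comult T (omap T X) \<odot> comult T X = amap T (comult T X) \<odot> comult T X"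

text \<open>A coalgebra is a pair of its carrier and its structure map.\<close>

definition coalgebra ::
    "('o, 'a, 'z) cat_scheme \<Rightarrow> ('o, 'a, 'y) comonad_data_scheme \<Rightarrow> 'o \<times> 'a \<Rightarrow> bool" where
  "coalgebra C T = (\<lambda>(A, \<alpha>).
    A \<in> Obj C \<and> \<alpha> \<in> Hom C A (omap T A) \<and>
    counit T A \<odot>\<^bsub>C\<^esub> \<alpha> = Ident C A \<and>
    comult T A \<odot>\<^bsub>C\<^esub> \<alpha> = amap T \<alpha> \<odot>\<^bsub>C\<^esub> \<alpha>)"

definition coalgebra_morphism ::
    "('o, 'a, 'z) cat_scheme \<Rightarrow> ('o, 'a, 'y) comonad_data_scheme
      \<Rightarrow> 'o \<times> 'a \<Rightarrow> 'o \<times> 'a \<Rightarrow> 'a \<Rightarrow> bool" where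
  "coalgebra_morphism C T = (\<lambda>(A, \<alpha>) (B, \<beta>) f.
    f \<in> Hom C A B \<and> \<beta> \<odot>\<^bsub>C\<^esub> f = amap T f \<odot>\<^bsub>C\<^esub> \<alpha>)"

text \<open>An arrow of the Eilenberg--Moore category is a triple \<open>(X, f, Y)\<close>: the underlying arrow \<open>f\<close>
  does not determine the structure maps of its source and target.\<close>

type_synonym ('o, 'a) em_arr = "('o \<times> 'a) \<times> 'a \<times> ('o \<times> 'a)"

abbreviation underlying :: "('o, 'a) em_arr \<Rightarrow> 'a" where
  "underlying h \<equiv> fst (snd h)"

definition EM ::
    "('o, 'a, 'z) cat_scheme \<Rightarrow> ('o, 'a, 'y) comonad_data_scheme
      \<Rightarrow> ('o \<times> 'a, ('o, 'a) em_arr) cat" where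
  "EM C T = \<lparr>
    Obj = {X. coalgebra C T X},
    Arr = {(X, f, Y) | X f Y.
      coalgebra C T X \<and> coalgebra C T Y \<and> coalgebra_morphism C T X Y f},
    Dom = (\<lambda>h. fst h),
    Cod = (\<lambda>h. snd (snd h)),
    Ident = (\<lambda>X. (X, Ident C (fst X), X)),
    Comp = (\<lambda>k h. (fst h, underlying k \<odot>\<^bsub>C\<^esub> underlying h, snd (snd k)))\<rparr>"

definition cofree :: "('o, 'a, 'y) comonad_data_scheme \<Rightarrow> 'o \<Rightarrow> 'o \<times> 'a" where
  "cofree T A = (omap T A, comult T A)"

definition preserves_embeddings :: "('o, 'a, 'y) comonad_data_scheme \<Rightarrow> 'a set \<Rightarrow> bool" where
  "preserves_embeddings T M \<longleftrightarrow> (\<forall>m\<in>M. amap T m \<in> M)"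

text \<open>Applied to \<open>E\<close> and to \<open>M\<close>, this gives the two classes of the lifted factorisation system.\<close>

definition lifted ::
    "('o, 'a, 'z) cat_scheme \<Rightarrow> ('o, 'a, 'y) comonad_data_scheme
      \<Rightarrow> 'a set \<Rightarrow> ('o, 'a) em_arr set" where
  "lifted C T K = {h \<in> Arr (EM C T). underlying h \<in> K}"

definition comonad_equivalent ::
    "('o, 'a, 'z) cat_scheme \<Rightarrow> ('o, 'a, 'y) comonad_data_scheme
      \<Rightarrow> 'a set \<Rightarrow> ('o \<times> 'a) set \<Rightarrow> 'o \<Rightarrow> 'o \<Rightarrow> bool" where
  "comonad_equivalent C T M Paths A B \<longleftrightarrow>
    (\<exists>Z. \<exists>f\<in>Hom (EM C T) Z (cofree T A). \<exists>g\<in>Hom (EM C T) Z (cofree T B).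
      open_arr (EM C T) (lifted C T M) Paths f \<and>
      pathwise_embedding (EM C T) (lifted C T M) Paths f \<and>
      open_arr (EM C T) (lifted C T M) Paths g \<and>
      pathwise_embedding (EM C T) (lifted C T M) Paths g)"


context comonad
begin

lemma EM_Hom_iff:
  "h \<in> Hom (EM C T) X Y \<longleftrightarrow>
    coalgebra C T X \<and> coalgebra C T Y \<and> (\<exists>f. h = (X, f, Y) \<and> coalgebra_morphism C T X Y f)"
  by (cases X, cases Y) (auto simp: Hom_def EM_def)

lemma EM_Obj_iff: "X \<in> Obj (EM C T) \<longleftrightarrow> coalgebra C T X"
  by (simp add: EM_def)

lemma EM_Ident: "Ident (EM C T) X = (X, Ident C (fst X), X)"
  by (simp add: EM_def)

lemma EM_Comp: "(Y', g, Z) \<odot>\<^bsub>EM C T\<^esub> (X, f, Y) = (X, g \<odot> f, Z)"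
  by (simp add: EM_def)

lemma coalgebra_morphism_Ident:
  assumes "coalgebra C T X"
  shows "coalgebra_morphism C T X X (Ident C (fst X))"
  using assms
  by (cases X) (auto simp: coalgebra_def coalgebra_morphism_def amap_Ident Ident_Hom
      Comp_Ident Ident_Comp)

lemma coalgebra_morphism_Comp:
  assumes X: "coalgebra C T X" and Y: "coalgebra C T Y" and Z: "coalgebra C T Z"
    and f: "coalgebra_morphism C T X Y f" and g: "coalgebra_morphism C T Y Z g"
  shows "coalgebra_morphism C T X Z (g \<odot> f)"
proof -
  obtain A \<alpha> B \<beta> D \<gamma> where eq: "X = (A, \<alpha>)" "Y = (B, \<beta>)" "Z = (D, \<gamma>)"
    by (cases X, cases Y, cases Z)
  have str: "\<alpha> \<in> Hom C A (omap T A)" "\<beta> \<in> Hom C B (omap T B)" "\<gamma> \<in> Hom C D (omap T D)"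
    using X Y Z by (auto simp: eq coalgebra_def)
  have f': "f \<in> Hom C A B" "\<beta> \<odot> f = amap T f \<odot> \<alpha>"
    and g': "g \<in> Hom C B D" "\<gamma> \<odot> g = amap T g \<odot> \<beta>"
    using f g by (auto simp: eq coalgebra_morphism_def)
  have "\<gamma> \<odot> (g \<odot> f) = (\<gamma> \<odot> g) \<odot> f"
    using Comp_assoc[OF f'(1) g'(1) str(3)] by simp
  also have "\<dots> = amap T g \<odot> (\<beta> \<odot> f)"
    using Comp_assoc[OF f'(1) str(2) amap_Hom[OF g'(1)]] g'(2) by simp
  also have "\<dots> = (amap T g \<odot> amap T f) \<odot> \<alpha>"
    using Comp_assoc[OF str(1) amap_Hom[OF f'(1)] amap_Hom[OF g'(1)]] f'(2) by simp
  also have "\<dots> = amap T (g \<odot> f) \<odot> \<alpha>"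
    using amap_Comp[OF f'(1) g'(1)] by simp
  finally show ?thesis
    using Comp_Hom[OF f'(1) g'(1)] by (simp add: eq coalgebra_morphism_def)
qed

lemma category_EM: "category (EM C T)"
proof
  show "g \<odot>\<^bsub>EM C T\<^esub> f \<in> Hom (EM C T) X Z"
    if "f \<in> Hom (EM C T) X Y" "g \<in> Hom (EM C T) Y Z" for f g X Y Z
    using that by (auto simp: EM_Hom_iff EM_Comp intro: coalgebra_morphism_Comp)
  show "(h \<odot>\<^bsub>EM C T\<^esub> g) \<odot>\<^bsub>EM C T\<^esub> f = h \<odot>\<^bsub>EM C T\<^esub> (g \<odot>\<^bsub>EM C T\<^esub> f)"
    if "f \<in> Hom (EM C T) W X" "g \<in> Hom (EM C T) X Y" "h \<in> Hom (EM C T) Y Z" for f g h W X Y Z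
    using that Comp_assoc
    by (auto simp: EM_Hom_iff coalgebra_morphism_def EM_Comp split: prod.splits)
  show "Dom (EM C T) f \<in> Obj (EM C T)" "Cod (EM C T) f \<in> Obj (EM C T)"
    if "f \<in> Arr (EM C T)" for f
    using that by (auto simp: EM_def)
  show "Ident (EM C T) X \<in> Hom (EM C T) X X" if "X \<in> Obj (EM C T)" for X
    using that by (simp add: EM_Hom_iff EM_Obj_iff EM_Ident coalgebra_morphism_Ident)
qed (auto simp: EM_Hom_iff EM_Ident EM_Comp coalgebra_morphism_def Comp_Ident Ident_Comp)

lemma cofree_Obj: "A \<in> Obj C \<Longrightarrow> cofree T A \<in> Obj (EM C T)"
  by (simp add: cofree_def EM_def coalgebra_def omap_Obj comult_Hom counit_comult comult_coassoc)

end

end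

(* In EM(C), open pathwise-embeddings are stable under products: a path mapping into a product maps
   into each factor through its image, which is again a path because paths are closed under
   quotients, so both conditions can be checked factor by factor. Being a right adjoint, the cofree
   functor turns the product of the A i into the product of the cofree coalgebras. The products of
   the apexes of the given spans exist because a coalgebra (A, a) is the equaliser of the
   maps amap a and comult A from cofree A to cofree (omap A), so a product of coalgebras is an
   equaliser of maps between cofree coalgebras on products. *)
theory Submission
  imports Defs
begin

section \<open>Products, equalisers and their interchange\<close>

context category
begin

lemma Hom_Obj:
  assumes "f \<in> Hom C X Y"
  shows "X \<in> Obj C" "Y \<in> Obj C"
  using assms Dom_Obj Cod_Obj by (auto simp: Hom_def)

lemma is_product_proj:
  "\<lbrakk>is_product C I A P \<pi>; i \<in> I\<rbrakk> \<Longrightarrow> \<pi> i \<in> Hom C P (A i)"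
  by (simp add: is_product_def)

lemma product_lift:
  assumes "is_product C I A P \<pi>" and X: "X \<in> Obj C" and "\<And>i. i \<in> I \<Longrightarrow> f i \<in> Hom C X (A i)"
  obtains h where "h \<in> Hom C X P" and "\<And>i. i \<in> I \<Longrightarrow> \<pi> i \<odot> h = f i"
  using assms(1)[unfolded is_product_def, THEN conjunct2, THEN conjunct2, THEN bspec[OF _ X],
      THEN spec[of _ f]] assms(3) that by blast

lemma product_cancel:
  assumes P: "is_product C I A P \<pi>" and h: "h \<in> Hom C X P" and k: "k \<in> Hom C X P"
    and eq: "\<And>i. i \<in> I \<Longrightarrow> \<pi> i \<odot> h = \<pi> i \<odot> k"
  shows "h = k"
proof -
  have "\<forall>i\<in>I. \<pi> i \<odot> k \<in> Hom C X (A i)"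
    using P k Comp_Hom unfolding is_product_def by blast
  then have "\<exists>!h. h \<in> Hom C X P \<and> (\<forall>i\<in>I. \<pi> i \<odot> h = \<pi> i \<odot> k)"
    using P[unfolded is_product_def, THEN conjunct2, THEN conjunct2, THEN bspec[OF _ Hom_Obj(1)[OF h]],
        THEN spec[of _ "\<lambda>i. \<pi> i \<odot> k"]] by blast
  then show ?thesis using h k eq by blast
qed

lemma product_map:
  assumes P: "is_product C I A P \<pi>" and Q: "is_product C I B Q \<rho>"
    and f: "\<And>i. i \<in> I \<Longrightarrow> f i \<in> Hom C (A i) (B i)"
  obtains h where "h \<in> Hom C P Q" and "\<And>i. i \<in> I \<Longrightarrow> \<rho> i \<odot> h = f i \<odot> \<pi> i"
proof -
  have "P \<in> Obj C" using P by (simp add: is_product_def)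
  moreover have "f i \<odot> \<pi> i \<in> Hom C P (B i)" if "i \<in> I" for i
    using Comp_Hom[OF is_product_proj[OF P that] f[OF that]] .
  ultimately show thesis
    using product_lift[OF Q, of P "\<lambda>i. f i \<odot> \<pi> i"] that by blast
qed

text \<open>Splits the universal property into existence of a mediating arrow and joint monicity of
  the projections; the latter mentions no cone and gives uniqueness for every cone at once.\<close>

lemma is_productI:
  assumes "P \<in> Obj C" and "\<And>i. i \<in> I \<Longrightarrow> \<pi> i \<in> Hom C P (A i)"
    and "\<And>X f. \<lbrakk>X \<in> Obj C; \<And>i. i \<in> I \<Longrightarrow> f i \<in> Hom C X (A i)\<rbrakk>
      \<Longrightarrow> \<exists>h \<in> Hom C X P. \<forall>i\<in>I. \<pi> i \<odot> h = f i"
    and "\<And>X h k. \<lbrakk>h \<in> Hom C X P; k \<in> Hom C X P; \<And>i. i \<in> I \<Longrightarrow> \<pi> i \<odot> h = \<pi> i \<odot> k\<rbrakk> \<Longrightarrow> h = k"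
  shows "is_product C I A P \<pi>"
  unfolding is_product_def
proof (intro conjI ballI allI impI)
  fix X f assume X: "X \<in> Obj C" and f: "\<forall>i\<in>I. f i \<in> Hom C X (A i)"
  from assms(3)[OF X, of f] f obtain h where h: "h \<in> Hom C X P" "\<forall>i\<in>I. \<pi> i \<odot> h = f i" by blast
  show "\<exists>!h. h \<in> Hom C X P \<and> (\<forall>i\<in>I. \<pi> i \<odot> h = f i)"
    using h assms(4) by (intro ex1I[of _ h]) auto
qed (fact assms(1,2))+

lemma is_equaliserD:
  assumes "is_equaliser C f g k" and f: "f \<in> Hom C X Y" and g: "g \<in> Hom C X Y"
  shows "k \<in> Hom C (Dom C k) X" and "f \<odot> k = g \<odot> k"
    and "\<And>W h. \<lbrakk>h \<in> Hom C W X; f \<odot> h = g \<odot> h\<rbrakk> \<Longrightarrow> \<exists>u\<in>Hom C W (Dom C k). k \<odot> u = h"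
    and "\<And>W u v. \<lbrakk>u \<in> Hom C W (Dom C k); v \<in> Hom C W (Dom C k); k \<odot> u = k \<odot> v\<rbrakk> \<Longrightarrow> u = v"
proof -
  note eq = assms(1)[unfolded is_equaliser_def]
  have D: "Dom C f = X" using f by (simp add: Hom_def)
  show k: "k \<in> Hom C (Dom C k) X" and fk: "f \<odot> k = g \<odot> k"
    using eq D by (auto simp: Hom_def)
  show "\<exists>u\<in>Hom C W (Dom C k). k \<odot> u = h" if "h \<in> Hom C W X" "f \<odot> h = g \<odot> h" for W h
    using eq D that by blast
  show "u = v" if u: "u \<in> Hom C W (Dom C k)" and v: "v \<in> Hom C W (Dom C k)" and e: "k \<odot> u = k \<odot> v"
    for W u v
  proof -
    \<comment> \<open>The arrow \<open>k \<odot> u\<close> itself equalises \<open>f\<close> and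
      \<open>g\<close>, so uniqueness of its factorisation through \<open>k\<close> makes
      \<open>k\<close> left cancellable.\<close>
    have "f \<odot> (k \<odot> u) = g \<odot> (k \<odot> u)"
      using Comp_assoc[OF u k f] Comp_assoc[OF u k g] fk by simp
    then have "\<exists>!w. w \<in> Hom C W (Dom C k) \<and> k \<odot> w = k \<odot> u"
      using eq D Comp_Hom[OF u k] by blast
    then show "u = v" using u v e by metis
  qed
qed

text \<open>Limits commute with limits: the families \<open>s\<close> and \<open>t\<close> induce a
  parallel pair \<open>s'\<close>, \<open>t'\<close> between the products, and the equaliser of this
  pair is a product of the equalisers \<open>k i\<close>. Thus products need only be known for the
  families \<open>Y\<close> and \<open>W\<close>.\<close>

lemma product_of_equalisers:
  assumes P: "is_product C I Y P p" and Q: "is_product C I W Q q"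
    and s: "\<And>i. i \<in> I \<Longrightarrow> s i \<in> Hom C (Y i) (W i)"
    and t: "\<And>i. i \<in> I \<Longrightarrow> t i \<in> Hom C (Y i) (W i)"
    and k: "\<And>i. i \<in> I \<Longrightarrow> is_equaliser C (s i) (t i) (k i)"
    and "has_equalisers C"
  obtains K r where "is_product C I (\<lambda>i. Dom C (k i)) K r"
proof -
  note k_eq = is_equaliserD[OF k s t]
  obtain s' where s': "s' \<in> Hom C P Q" "\<And>i. i \<in> I \<Longrightarrow> q i \<odot> s' = s i \<odot> p i"
    using product_map[OF P Q s] by blast
  obtain t' where t': "t' \<in> Hom C P Q" "\<And>i. i \<in> I \<Longrightarrow> q i \<odot> t' = t i \<odot> p i"
    using product_map[OF P Q t] by blast
  obtain k' where k': "is_equaliser C s' t' k'"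
    using \<open>has_equalisers C\<close> s'(1) t'(1) unfolding has_equalisers_def by blast
  note k'_eq = is_equaliserD[OF k' s'(1) t'(1)]
  have pk: "p i \<odot> k' \<in> Hom C (Dom C k') (Y i)" if "i \<in> I" for i
    using Comp_Hom[OF k'_eq(1) is_product_proj[OF P that]] .
  \<comment> \<open>The projections: since \<open>s'\<close> and \<open>t'\<close> lie over
    \<open>s i\<close> and \<open>t i\<close>, the arrow \<open>p i \<odot> k'\<close> equalises the
    latter two and so factors through \<open>k i\<close>.\<close>
  have "\<exists>r\<in>Hom C (Dom C k') (Dom C (k i)). k i \<odot> r = p i \<odot> k'" if i: "i \<in> I" for i
  proof (rule k_eq(3)[OF i i i pk[OF i]])
    note pi = is_product_proj[OF P i] and qi = is_product_proj[OF Q i]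
    have "s i \<odot> (p i \<odot> k') = q i \<odot> (s' \<odot> k')"
      using Comp_assoc[OF k'_eq(1) pi s[OF i]] Comp_assoc[OF k'_eq(1) s'(1) qi] s'(2)[OF i] by simp
    also have "\<dots> = t i \<odot> (p i \<odot> k')"
      using Comp_assoc[OF k'_eq(1) pi t[OF i]] Comp_assoc[OF k'_eq(1) t'(1) qi] t'(2)[OF i] k'_eq(2)
      by simp
    finally show "s i \<odot> (p i \<odot> k') = t i \<odot> (p i \<odot> k')" .
  qed
  then obtain r where r: "\<And>i. i \<in> I \<Longrightarrow> r i \<in> Hom C (Dom C k') (Dom C (k i))"
    and kr: "\<And>i. i \<in> I \<Longrightarrow> k i \<odot> r i = p i \<odot> k'"
    by metis
  have assoc: "k i \<odot> (r i \<odot> u) = p i \<odot> (k' \<odot> u)" if i: "i \<in> I" and u: "u \<in> Hom C X (Dom C k')" for i u X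
    using Comp_assoc[OF u r[OF i] k_eq(1)[OF i i i]] kr[OF i]
      Comp_assoc[OF u k'_eq(1) is_product_proj[OF P i]] by simp
  have "is_product C I (\<lambda>i. Dom C (k i)) (Dom C k') r"
  proof (rule is_productI)
    show "Dom C k' \<in> Obj C" using Hom_Obj(1)[OF k'_eq(1)] .
    fix X f assume X: "X \<in> Obj C" and f: "\<And>i. i \<in> I \<Longrightarrow> f i \<in> Hom C X (Dom C (k i))"
    have kf: "k i \<odot> f i \<in> Hom C X (Y i)" if i: "i \<in> I" for i
      using Comp_Hom[OF f[OF i] k_eq(1)[OF i i i]] .
    obtain h where h: "h \<in> Hom C X P" "\<And>i. i \<in> I \<Longrightarrow> p i \<odot> h = k i \<odot> f i"
      using product_lift[OF P X kf] by blast
    \<comment> \<open>Both sides agree after every \<open>q i\<close>, because there they become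
      \<open>s i\<close> and \<open>t i\<close> applied after \<open>k i\<close>. Hence
      \<open>h\<close> factors through \<open>k'\<close>.\<close>
    have "s' \<odot> h = t' \<odot> h"
    proof (rule product_cancel[OF Q Comp_Hom[OF h(1) s'(1)] Comp_Hom[OF h(1) t'(1)]])
      fix i assume i: "i \<in> I"
      note pi = is_product_proj[OF P i] and qi = is_product_proj[OF Q i] and ki = k_eq(1)[OF i i i]
      have "q i \<odot> (s' \<odot> h) = s i \<odot> (k i \<odot> f i)"
        using Comp_assoc[OF h(1) s'(1) qi] Comp_assoc[OF h(1) pi s[OF i]] s'(2)[OF i] h(2)[OF i] by simp
      also have "\<dots> = t i \<odot> (k i \<odot> f i)"
        using Comp_assoc[OF f[OF i] ki s[OF i]] Comp_assoc[OF f[OF i] ki t[OF i]] k_eq(2)[OF i i i]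
        by simp
      also have "\<dots> = q i \<odot> (t' \<odot> h)"
        using Comp_assoc[OF h(1) t'(1) qi] Comp_assoc[OF h(1) pi t[OF i]] t'(2)[OF i] h(2)[OF i] by simp
      finally show "q i \<odot> (s' \<odot> h) = q i \<odot> (t' \<odot> h)" .
    qed
    then obtain u where u: "u \<in> Hom C X (Dom C k')" "k' \<odot> u = h"
      using k'_eq(3)[OF h(1)] by blast
    have "r i \<odot> u = f i" if i: "i \<in> I" for i
      using k_eq(4)[OF i i i Comp_Hom[OF u(1) r[OF i]] f[OF i]] assoc[OF i u(1)] u(2) h(2)[OF i] by simp
    then show "\<exists>h\<in>Hom C X (Dom C k'). \<forall>i\<in>I. r i \<odot> h = f i" using u(1) by blast
  next
    fix X u v
    assume u: "u \<in> Hom C X (Dom C k')" and v: "v \<in> Hom C X (Dom C k')"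
      and uv: "\<And>i. i \<in> I \<Longrightarrow> r i \<odot> u = r i \<odot> v"
    \<comment> \<open>Composing \<open>uv\<close> with \<open>k i\<close> turns \<open>r i\<close>
      into \<open>p i \<odot> k'\<close>, and the \<open>p i\<close> are jointly monic.\<close>
    have "k' \<odot> u = k' \<odot> v"
      by (rule product_cancel[OF P Comp_Hom[OF u k'_eq(1)] Comp_Hom[OF v k'_eq(1)]])
        (metis assoc u v uv)
    then show "u = v" using k'_eq(4)[OF u v] by simp
  qed (rule r)
  then show thesis using that by blast
qed

end

section \<open>Diagonal fillers and cancellation of embeddings\<close>

context proper_factorisation_system
begin

lemma E_Arr: "e \<in> E \<Longrightarrow> e \<in> Arr C"
  using equalityD1[OF E_eq] by blast

lemma M_Arr: "m \<in> M \<Longrightarrow> m \<in> Arr C"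
  using equalityD1[OF M_eq] by blast

lemma diagonal_filler:
  assumes "e \<in> E" and "m \<in> M" and e: "e \<in> Hom C X Y" and m: "m \<in> Hom C W Z"
    and "u \<in> Hom C X W" and "v \<in> Hom C Y Z" and "v \<odot> e = m \<odot> u"
  obtains d where "d \<in> Hom C Y W" and "d \<odot> e = u" and "m \<odot> d = v"
proof -
  have "weakly_orthogonal C e m"
    using equalityD1[OF E_eq] \<open>e \<in> E\<close> \<open>m \<in> M\<close> by blast
  moreover have "Dom C e = X" "Cod C e = Y" "Dom C m = W" "Cod C m = Z"
    using e m by (auto simp: Hom_def)
  ultimately have "\<exists>d\<in>Hom C Y W. d \<odot> e = u \<and> m \<odot> d = v"
    using assms(5-7) unfolding weakly_orthogonal_def by blast
  then show thesis using that by blast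
qed

lemma M_I:
  assumes m: "m \<in> Hom C W Z"
    and fill: "\<And>e X Y u v. \<lbrakk>e \<in> E; e \<in> Hom C X Y; u \<in> Hom C X W; v \<in> Hom C Y Z; v \<odot> e = m \<odot> u\<rbrakk>
      \<Longrightarrow> \<exists>d\<in>Hom C Y W. d \<odot> e = u \<and> m \<odot> d = v"
  shows "m \<in> M"
proof -
  have "weakly_orthogonal C e m" if e: "e \<in> E" for e
  proof -
    have "e \<in> Arr C" using e by (rule E_Arr)
    then have "e \<in> Hom C (Dom C e) (Cod C e)" by (simp add: Hom_def)
    moreover have "Dom C m = W" "Cod C m = Z" using m by (auto simp: Hom_def)
    ultimately show ?thesis
      using fill[OF e] unfolding weakly_orthogonal_def by blast
  qed
  moreover have "m \<in> Arr C" using m by (simp add: Hom_def)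
  ultimately show ?thesis using equalityD2[OF M_eq] by blast
qed

text \<open>A square from a quotient to \<open>g\<close> becomes, after composing with
  \<open>n\<close>, a square to the embedding \<open>n \<odot> g\<close>. The filler of that square
  also fills the original one, because \<open>n\<close> is monic.\<close>

lemma M_left_cancel:
  assumes nM: "n \<in> M" and ngM: "n \<odot> g \<in> M" and g: "g \<in> Hom C X Y" and n: "n \<in> Hom C Y Z"
  shows "g \<in> M"
proof (rule M_I[OF g])
  fix e V W u v
  assume e: "e \<in> E" "e \<in> Hom C V W" and u: "u \<in> Hom C V X" and v: "v \<in> Hom C W Y"
    and eq: "v \<odot> e = g \<odot> u"
  have "(n \<odot> v) \<odot> e = (n \<odot> g) \<odot> u"
    using Comp_assoc[OF e(2) v n] Comp_assoc[OF u g n] eq by simp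
  then obtain d where d: "d \<in> Hom C W X" "d \<odot> e = u" "(n \<odot> g) \<odot> d = n \<odot> v"
    using diagonal_filler[OF e(1) ngM e(2) Comp_Hom[OF g n] u Comp_Hom[OF v n]] by blast
  then have "n \<odot> (g \<odot> d) = n \<odot> v"
    using Comp_assoc[OF d(1) g n] by simp
  moreover have "Dom C n = Y" using n by (simp add: Hom_def)
  ultimately have "g \<odot> d = v"
    using M_mono[OF nM] Comp_Hom[OF d(1) g] v unfolding mono_arr_def by blast
  then show "\<exists>d\<in>Hom C W X. d \<odot> e = u \<and> g \<odot> d = v" using d by blast
qed

end

section \<open>Images of paths\<close>

context path_category
begin

text \<open>The image of a path is a quotient of it, hence a path. This is the point where closure
  under quotients enters.\<close>

lemma path_factorisation:
  assumes "closed_under_quotients C E Paths" and "P \<in> Paths" and "f \<in> Hom C P X"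
  obtains Q e m where "e \<in> Hom C P Q" "m \<in> Hom C Q X" "e \<in> E" "m \<in> M" "f = m \<odot> e" "Q \<in> Paths"
proof -
  obtain Q e m where f: "e \<in> Hom C P Q" "m \<in> Hom C Q X" "e \<in> E" "m \<in> M" "f = m \<odot> e"
    using factorisation[OF assms(3)] by blast
  moreover have "Dom C e = P" "Cod C e = Q" using f(1) by (auto simp: Hom_def)
  then have "Q \<in> Paths"
    using assms(1,2) f(3) unfolding closed_under_quotients_def by blast
  ultimately show thesis using that by blast
qed

lemma pathwise_embeddingD:
  assumes "pathwise_embedding C M Paths f" "f \<in> Hom C X Y" "m \<in> M" "m \<in> Hom C P X" "P \<in> Paths"
  shows "f \<odot> m \<in> M"
  using assms unfolding pathwise_embedding_def path_embedding_def Hom_def by auto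

lemma open_arrD:
  assumes "open_arr C M Paths f" "f \<in> Hom C X Y"
    and "e \<in> Hom C P X" "g \<in> Hom C P Q" "m \<in> Hom C Q Y" "e \<in> M" "g \<in> M" "m \<in> M"
    and "P \<in> Paths" "Q \<in> Paths" "f \<odot> e = m \<odot> g"
  obtains d where "d \<in> Hom C Q X" "d \<odot> g = e" "f \<odot> d = m"
proof -
  have "Dom C f = X" "Cod C f = Y" "Dom C e = P" "Dom C g = P" "Dom C m = Q"
    using assms(2-5) by (auto simp: Hom_def)
  then have "\<exists>d\<in>Hom C Q X. d \<odot> g = e \<and> f \<odot> d = m"
    using assms(1)[unfolded open_arr_def path_embedding_def, THEN conjunct2,
        THEN spec[of _ P], THEN spec[of _ Q], THEN bspec[of _ _ e], THEN bspec[of _ _ g],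
        THEN bspec[of _ _ m], THEN mp] assms(3-) by simp
  then show thesis using that by blast
qed

section \<open>Products of open pathwise-embeddings\<close>

context
  fixes I :: "'i set" and X Y p q f PX PY h
  assumes closed: "closed_under_quotients C E Paths"
    and PX: "is_product C I X PX p" and PY: "is_product C I Y PY q"
    and f: "\<And>i. i \<in> I \<Longrightarrow> f i \<in> Hom C (X i) (Y i)"
    and pathwise: "\<And>i. i \<in> I \<Longrightarrow> pathwise_embedding C M Paths (f i)"
    and h: "h \<in> Hom C PX PY" and qh: "\<And>i. i \<in> I \<Longrightarrow> q i \<odot> h = f i \<odot> p i"
begin

text \<open>For a path embedding \<open>e\<close>, the square from a quotient \<open>r\<close> to
  \<open>h \<odot> e\<close> is filled in two stages. First an arrow \<open>x\<close> into
  \<open>PX\<close> is built componentwise; then \<open>x\<close> is lifted through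
  \<open>e\<close>, which is an embedding. A component \<open>p i \<odot> e\<close> need not be an
  embedding, so its image is used instead.\<close>

lemma product_pathwise_embedding: "pathwise_embedding C M Paths h"
  unfolding pathwise_embedding_def path_embedding_def
proof (intro conjI allI impI; (elim conjE)?)
  show "h \<in> Arr C" using h by (simp add: Hom_def)
  fix e assume eM: "e \<in> M" and path: "Dom C e \<in> Paths" and cod: "Cod C e = Dom C h"
  let ?P = "Dom C e"
  have "e \<in> Arr C" using eM by (rule M_Arr)
  then have e: "e \<in> Hom C ?P PX" using cod h by (simp add: Hom_def)
  show "h \<odot> e \<in> M"
  proof (rule M_I[OF Comp_Hom[OF e h]])
    fix r V W u v
    assume r: "r \<in> E" "r \<in> Hom C V W" and u: "u \<in> Hom C V ?P" and v: "v \<in> Hom C W PY"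
      and eq: "v \<odot> r = (h \<odot> e) \<odot> u"
    have "\<exists>w\<in>Hom C W (X i). w \<odot> r = p i \<odot> (e \<odot> u) \<and> f i \<odot> w = q i \<odot> v" if i: "i \<in> I" for i
    proof -
      note pi = is_product_proj[OF PX i] and qi = is_product_proj[OF PY i] and fi = f[OF i]
      obtain Q a m where a: "a \<in> Hom C ?P Q" and m: "m \<in> Hom C Q (X i)" "m \<in> M"
        and pe: "p i \<odot> e = m \<odot> a" and Q: "Q \<in> Paths"
        using path_factorisation[OF closed path Comp_Hom[OF e pi]] by blast
      have "(q i \<odot> v) \<odot> r = q i \<odot> (h \<odot> (e \<odot> u))"
        using Comp_assoc[OF r(2) v qi] eq Comp_assoc[OF u e h] by simp
      also have "\<dots> = f i \<odot> (p i \<odot> (e \<odot> u))"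
        using Comp_assoc[OF Comp_Hom[OF u e] h qi] qh[OF i] Comp_assoc[OF Comp_Hom[OF u e] pi fi] by simp
      also have pu: "p i \<odot> (e \<odot> u) = m \<odot> (a \<odot> u)"
        using Comp_assoc[OF u e pi] pe Comp_assoc[OF u a m(1)] by simp
      also have "f i \<odot> (m \<odot> (a \<odot> u)) = (f i \<odot> m) \<odot> (a \<odot> u)"
        using Comp_assoc[OF Comp_Hom[OF u a] m(1) fi] by simp
      \<comment> \<open>Here \<open>m\<close> is a path embedding, so \<open>f i \<odot> m\<close>
        is an embedding and the quotient \<open>r\<close> lifts against it.\<close>
      finally obtain d where d: "d \<in> Hom C W Q" "d \<odot> r = a \<odot> u" "(f i \<odot> m) \<odot> d = q i \<odot> v"
        using diagonal_filler[OF r(1) pathwise_embeddingD[OF pathwise[OF i] fi m(2,1) Q] r(2)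
            Comp_Hom[OF m(1) fi] Comp_Hom[OF u a] Comp_Hom[OF v qi]] by blast
      then have "(m \<odot> d) \<odot> r = p i \<odot> (e \<odot> u)" "f i \<odot> (m \<odot> d) = q i \<odot> v"
        using Comp_assoc[OF r(2) d(1) m(1)] Comp_assoc[OF d(1) m(1) fi] pu by simp_all
      then show ?thesis using Comp_Hom[OF d(1) m(1)] by blast
    qed
    then obtain w where w: "\<And>i. i \<in> I \<Longrightarrow> w i \<in> Hom C W (X i)"
      and wr: "\<And>i. i \<in> I \<Longrightarrow> w i \<odot> r = p i \<odot> (e \<odot> u)"
      and fw: "\<And>i. i \<in> I \<Longrightarrow> f i \<odot> w i = q i \<odot> v"
      by metis
    obtain x where x: "x \<in> Hom C W PX" "\<And>i. i \<in> I \<Longrightarrow> p i \<odot> x = w i"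
      using product_lift[OF PX Hom_Obj(1)[OF v] w] by blast
    have "x \<odot> r = e \<odot> u"
    proof (rule product_cancel[OF PX Comp_Hom[OF r(2) x(1)] Comp_Hom[OF u e]])
      show "p i \<odot> (x \<odot> r) = p i \<odot> (e \<odot> u)" if i: "i \<in> I" for i
        using Comp_assoc[OF r(2) x(1) is_product_proj[OF PX i]] x(2)[OF i] wr[OF i] by simp
    qed
    \<comment> \<open>The square now has \<open>e\<close> on the right and \<open>x\<close> at the
      bottom, so its filler lands in the path itself.\<close>
    then obtain d where d: "d \<in> Hom C W ?P" "d \<odot> r = u" "e \<odot> d = x"
      using diagonal_filler[OF r(1) eM r(2) e u x(1)] by blast
    have "h \<odot> x = v"
    proof (rule product_cancel[OF PY Comp_Hom[OF x(1) h] v])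
      show "q i \<odot> (h \<odot> x) = q i \<odot> v" if i: "i \<in> I" for i
        using Comp_assoc[OF x(1) h is_product_proj[OF PY i]] qh[OF i]
          Comp_assoc[OF x(1) is_product_proj[OF PX i] f[OF i]] x(2)[OF i] fw[OF i] by simp
    qed
    then have "(h \<odot> e) \<odot> d = v"
      using Comp_assoc[OF d(1) e h] d(3) by simp
    then show "\<exists>d\<in>Hom C W ?P. d \<odot> r = u \<and> (h \<odot> e) \<odot> d = v" using d by blast
  qed
qed

text \<open>Openness of \<open>f i\<close> does not apply directly, since
  \<open>p i \<odot> e\<close> and \<open>q i \<odot> m\<close> need not be embeddings. Both are
  replaced by their images, which are paths. The lift found there is precomposed with the quotient
  \<open>b\<close>, and the resulting components are paired to an arrow into
  \<open>PX\<close>.\<close>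

lemma product_open:
  assumes opn: "\<And>i. i \<in> I \<Longrightarrow> open_arr C M Paths (f i)"
  shows "open_arr C M Paths h"
  unfolding open_arr_def path_embedding_def
proof (intro conjI allI ballI impI; (elim conjE)?)
  show "h \<in> Arr C" using h by (simp add: Hom_def)
  fix P Q e g m
  assume e: "e \<in> Hom C P (Dom C h)" and g: "g \<in> Hom C P Q" and m: "m \<in> Hom C Q (Cod C h)"
    and eM: "e \<in> M" and gM: "g \<in> M" and mM: "m \<in> M"
    and "Dom C e \<in> Paths" and "Dom C m \<in> Paths" and sq: "h \<odot> e = m \<odot> g"
  then have P: "P \<in> Paths" and Q: "Q \<in> Paths" by (auto simp: Hom_def)
  have dom: "Dom C h = PX" and cod: "Cod C h = PY" using h by (auto simp: Hom_def)
  note e = e[unfolded dom] and m = m[unfolded cod]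
  have "\<exists>w\<in>Hom C Q (X i). w \<odot> g = p i \<odot> e \<and> f i \<odot> w = q i \<odot> m" if i: "i \<in> I" for i
  proof -
    note pi = is_product_proj[OF PX i] and qi = is_product_proj[OF PY i] and fi = f[OF i]
    obtain P' a j where a: "a \<in> Hom C P P'" "a \<in> E" and j: "j \<in> Hom C P' (X i)" "j \<in> M"
      and pe: "p i \<odot> e = j \<odot> a" and P': "P' \<in> Paths"
      using path_factorisation[OF closed P Comp_Hom[OF e pi]] by blast
    obtain Q' b n where b: "b \<in> Hom C Q Q'" and n: "n \<in> Hom C Q' (Y i)" "n \<in> M"
      and qm: "q i \<odot> m = n \<odot> b" and Q': "Q' \<in> Paths"
      using path_factorisation[OF closed Q Comp_Hom[OF m qi]] by blast
    have fj: "f i \<odot> j \<in> M" using pathwise_embeddingD[OF pathwise[OF i] fi j(2,1) P'] .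
    have "(f i \<odot> j) \<odot> a = f i \<odot> (p i \<odot> e)"
      using Comp_assoc[OF a(1) j(1) fi] pe by simp
    also have "\<dots> = q i \<odot> (h \<odot> e)"
      using Comp_assoc[OF e pi fi] qh[OF i] Comp_assoc[OF e h qi] by simp
    also have "\<dots> = n \<odot> (b \<odot> g)"
      using sq Comp_assoc[OF g m qi] qm Comp_assoc[OF g b n(1)] by simp
    \<comment> \<open>The induced arrow between the two images, as a filler of the quotient
      \<open>a\<close> against the embedding \<open>n\<close>.\<close>
    finally obtain c where c: "c \<in> Hom C P' Q'" "c \<odot> a = b \<odot> g" "n \<odot> c = f i \<odot> j"
      using diagonal_filler[OF a(2) n(2) a(1) n(1) Comp_Hom[OF g b] Comp_Hom[OF j(1) fi]] by blast
    \<comment> \<open>Its composite with \<open>n\<close> is \<open>f i \<odot> j\<close>, an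
      embedding because \<open>f i\<close> is a pathwise-embedding. So the square of
      \<open>j\<close>, \<open>c\<close> and \<open>n\<close> is one to which openness of
      \<open>f i\<close> applies.\<close>
    have "c \<in> M" using M_left_cancel[OF n(2) _ c(1) n(1)] c(3) fj by simp
    then obtain d where d: "d \<in> Hom C Q' (X i)" "d \<odot> c = j" "f i \<odot> d = n"
      using open_arrD[OF opn[OF i] fi j(1) c(1) n(1) j(2) \<open>c \<in> M\<close> n(2) P' Q'] c(3) by metis
    have "(d \<odot> b) \<odot> g = p i \<odot> e"
      using Comp_assoc[OF g b d(1)] c(2) Comp_assoc[OF a(1) c(1) d(1)] d(2) pe by simp
    moreover have "f i \<odot> (d \<odot> b) = q i \<odot> m"
      using Comp_assoc[OF b d(1) fi] d(3) qm by simp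
    ultimately show ?thesis using Comp_Hom[OF b d(1)] by blast
  qed
  then obtain w where w: "\<And>i. i \<in> I \<Longrightarrow> w i \<in> Hom C Q (X i)"
    and wg: "\<And>i. i \<in> I \<Longrightarrow> w i \<odot> g = p i \<odot> e"
    and fw: "\<And>i. i \<in> I \<Longrightarrow> f i \<odot> w i = q i \<odot> m"
    by metis
  obtain d where d: "d \<in> Hom C Q PX" "\<And>i. i \<in> I \<Longrightarrow> p i \<odot> d = w i"
    using product_lift[OF PX Hom_Obj(1)[OF m] w] by blast
  have "d \<odot> g = e"
  proof (rule product_cancel[OF PX Comp_Hom[OF g d(1)] e])
    show "p i \<odot> (d \<odot> g) = p i \<odot> e" if i: "i \<in> I" for i
      using Comp_assoc[OF g d(1) is_product_proj[OF PX i]] d(2)[OF i] wg[OF i] by simp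
  qed
  moreover have "h \<odot> d = m"
  proof (rule product_cancel[OF PY Comp_Hom[OF d(1) h] m])
    show "q i \<odot> (h \<odot> d) = q i \<odot> m" if i: "i \<in> I" for i
      using Comp_assoc[OF d(1) h is_product_proj[OF PY i]] qh[OF i]
        Comp_assoc[OF d(1) is_product_proj[OF PX i] f[OF i]] d(2)[OF i] fw[OF i] by simp
  qed
  ultimately show "\<exists>d\<in>Hom C Q (Dom C h). d \<odot> g = e \<and> h \<odot> d = m" using d(1) dom by blast
qed

end

end

section \<open>The cofree adjunction and products of coalgebras\<close>

context comonad
begin

lemma cofree_map:
  assumes f: "f \<in> Hom C A B"
  shows "(cofree T A, amap T f, cofree T B) \<in> Hom (EM C T) (cofree T A) (cofree T B)"
  using cofree_Obj[OF Hom_Obj(1)[OF f]] cofree_Obj[OF Hom_Obj(2)[OF f]] amap_Hom[OF f]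
    comult_natural[OF f]
  by (simp add: EM_Hom_iff EM_Obj_iff) (simp add: cofree_def coalgebra_morphism_def)

text \<open>The adjunction between the forgetful and the cofree functor:
  \<open>amap T f \<odot> \<xi>\<close> is the transpose of \<open>f\<close>, and composing with the
  counit recovers \<open>f\<close>. Naturality of the comultiplication and coassociativity of
  \<open>\<xi>\<close> make it a morphism.\<close>

lemma cofree_transpose:
  assumes X: "coalgebra C T (X, \<xi>)" and f: "f \<in> Hom C X A"
  shows "coalgebra_morphism C T (X, \<xi>) (cofree T A) (amap T f \<odot> \<xi>)"
    and "counit T A \<odot> (amap T f \<odot> \<xi>) = f"
proof -
  have x: "\<xi> \<in> Hom C X (omap T X)" "counit T X \<odot> \<xi> = Ident C X" "comult T X \<odot> \<xi> = amap T \<xi> \<odot> \<xi>"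
    "X \<in> Obj C"
    using X by (auto simp: coalgebra_def)
  have A: "A \<in> Obj C" using Hom_Obj(2)[OF f] .
  note Tf = amap_Hom[OF f]
  have "comult T A \<odot> (amap T f \<odot> \<xi>) = (amap T (amap T f) \<odot> comult T X) \<odot> \<xi>"
    using Comp_assoc[OF x(1) Tf comult_Hom[OF A]] comult_natural[OF f] by simp
  also have "\<dots> = amap T (amap T f) \<odot> (amap T \<xi> \<odot> \<xi>)"
    using Comp_assoc[OF x(1) comult_Hom[OF x(4)] amap_Hom[OF Tf]] x(3) by simp
  also have "\<dots> = amap T (amap T f \<odot> \<xi>) \<odot> \<xi>"
    using Comp_assoc[OF x(1) amap_Hom[OF x(1)] amap_Hom[OF Tf]] amap_Comp[OF x(1) Tf] by simp
  finally show "coalgebra_morphism C T (X, \<xi>) (cofree T A) (amap T f \<odot> \<xi>)"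
    using Comp_Hom[OF x(1) Tf] by (simp add: cofree_def coalgebra_morphism_def)
  have "counit T A \<odot> (amap T f \<odot> \<xi>) = f \<odot> (counit T X \<odot> \<xi>)"
    using Comp_assoc[OF x(1) Tf counit_Hom[OF A]] counit_natural[OF f]
      Comp_assoc[OF x(1) counit_Hom[OF x(4)] f] by simp
  then show "counit T A \<odot> (amap T f \<odot> \<xi>) = f" using x(2) Comp_Ident[OF f] by simp
qed

text \<open>The other half of the bijection, so a coalgebra morphism into a cofree coalgebra is
  determined by its composite with the counit.\<close>

lemma transpose_counit:
  assumes X: "coalgebra C T (X, \<xi>)" and A: "A \<in> Obj C"
    and h: "coalgebra_morphism C T (X, \<xi>) (cofree T A) h"
  shows "amap T (counit T A \<odot> h) \<odot> \<xi> = h"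
proof -
  have x: "\<xi> \<in> Hom C X (omap T X)" using X by (simp add: coalgebra_def)
  have h': "h \<in> Hom C X (omap T A)" "comult T A \<odot> h = amap T h \<odot> \<xi>"
    using h by (auto simp: cofree_def coalgebra_morphism_def)
  note c = counit_Hom[OF A]
  have "amap T (counit T A \<odot> h) \<odot> \<xi> = amap T (counit T A) \<odot> (comult T A \<odot> h)"
    using amap_Comp[OF h'(1) c] Comp_assoc[OF x amap_Hom[OF h'(1)] amap_Hom[OF c]] h'(2) by simp
  also have "\<dots> = h"
    using Comp_assoc[OF h'(1) comult_Hom[OF A] amap_Hom[OF c]] amap_counit_comult[OF A]
      Ident_Comp[OF h'(1)] by simp
  finally show ?thesis .
qed

text \<open>Right adjoints preserve products: a cone is transposed to the base category, paired
  there, and transposed back.\<close>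

lemma cofree_product:
  assumes P: "is_product C I A P \<pi>" and A: "\<And>i. i \<in> I \<Longrightarrow> A i \<in> Obj C"
  shows "is_product (EM C T) I (\<lambda>i. cofree T (A i)) (cofree T P)
    (\<lambda>i. (cofree T P, amap T (\<pi> i), cofree T (A i)))"
proof -
  interpret EM: category "EM C T" by (rule category_EM)
  have PO: "P \<in> Obj C" using P by (simp add: is_product_def)
  show ?thesis
  proof (rule EM.is_productI)
    show "cofree T P \<in> Obj (EM C T)" using cofree_Obj[OF PO] .
    show "(cofree T P, amap T (\<pi> i), cofree T (A i)) \<in> Hom (EM C T) (cofree T P) (cofree T (A i))"
      if "i \<in> I" for i
      using cofree_map[OF is_product_proj[OF P that]] .
  next
    fix Z f
    assume Z: "Z \<in> Obj (EM C T)" and f: "\<And>i. i \<in> I \<Longrightarrow> f i \<in> Hom (EM C T) Z (cofree T (A i))"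
    obtain X \<xi> where Zeq: "Z = (X, \<xi>)" by (cases Z)
    have X: "coalgebra C T (X, \<xi>)" using Z by (simp add: Zeq EM_Obj_iff)
    then have x: "\<xi> \<in> Hom C X (omap T X)" "X \<in> Obj C" by (auto simp: coalgebra_def)
    have f_eq: "f i = (Z, underlying (f i), cofree T (A i))"
      and f_mor: "coalgebra_morphism C T (X, \<xi>) (cofree T (A i)) (underlying (f i))" if "i \<in> I" for i
      using f[OF that] by (auto simp: EM_Hom_iff Zeq)
    have fH: "underlying (f i) \<in> Hom C X (omap T (A i))" if "i \<in> I" for i
      using f_mor[OF that] by (simp add: cofree_def coalgebra_morphism_def)
    have "counit T (A i) \<odot> underlying (f i) \<in> Hom C X (A i)" if i: "i \<in> I" for i
      using Comp_Hom[OF fH[OF i] counit_Hom[OF A[OF i]]] .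
    then obtain g where g: "g \<in> Hom C X P"
      and \<pi>g: "\<And>i. i \<in> I \<Longrightarrow> \<pi> i \<odot> g = counit T (A i) \<odot> underlying (f i)"
      using product_lift[OF P x(2), of "\<lambda>i. counit T (A i) \<odot> underlying (f i)"] by blast
    have "amap T (\<pi> i) \<odot> (amap T g \<odot> \<xi>) = underlying (f i)" if i: "i \<in> I" for i
      using amap_Comp[OF g is_product_proj[OF P i]] transpose_counit[OF X A[OF i] f_mor[OF i]] \<pi>g[OF i]
        Comp_assoc[OF x(1) amap_Hom[OF g] amap_Hom[OF is_product_proj[OF P i]]] by simp
    then have "(cofree T P, amap T (\<pi> i), cofree T (A i)) \<odot>\<^bsub>EM C T\<^esub>
        (Z, amap T g \<odot> \<xi>, cofree T P) = f i" if "i \<in> I" for i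
      using that by (simp add: EM_Comp f_eq[OF that, symmetric])
    moreover have "(Z, amap T g \<odot> \<xi>, cofree T P) \<in> Hom (EM C T) Z (cofree T P)"
      using cofree_transpose(1)[OF X g] X cofree_Obj[OF PO] by (simp add: EM_Hom_iff EM_Obj_iff Zeq)
    ultimately show "\<exists>h\<in>Hom (EM C T) Z (cofree T P).
        \<forall>i\<in>I. (cofree T P, amap T (\<pi> i), cofree T (A i)) \<odot>\<^bsub>EM C T\<^esub> h = f i"
      by blast
  next
    fix Z h k
    assume h: "h \<in> Hom (EM C T) Z (cofree T P)" and k: "k \<in> Hom (EM C T) Z (cofree T P)"
      and eq: "\<And>i. i \<in> I \<Longrightarrow> (cofree T P, amap T (\<pi> i), cofree T (A i)) \<odot>\<^bsub>EM C T\<^esub> h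
        = (cofree T P, amap T (\<pi> i), cofree T (A i)) \<odot>\<^bsub>EM C T\<^esub> k"
    obtain X \<xi> where Zeq: "Z = (X, \<xi>)" by (cases Z)
    obtain h' k' where h': "h = (Z, h', cofree T P)" "coalgebra_morphism C T (X, \<xi>) (cofree T P) h'"
      and k': "k = (Z, k', cofree T P)" "coalgebra_morphism C T (X, \<xi>) (cofree T P) k'"
      and X: "coalgebra C T (X, \<xi>)"
      using h k by (auto simp: EM_Hom_iff Zeq)
    have hH: "h' \<in> Hom C X (omap T P)" and kH: "k' \<in> Hom C X (omap T P)"
      using h'(2) k'(2) by (auto simp: cofree_def coalgebra_morphism_def)
    note c = counit_Hom[OF PO]
    \<comment> \<open>Comparing transposes suffices. Naturality of the counit moves each
      \<open>\<pi> i\<close> past it, where \<open>eq\<close> applies.\<close>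
    have "counit T P \<odot> h' = counit T P \<odot> k'"
    proof (rule product_cancel[OF P Comp_Hom[OF hH c] Comp_Hom[OF kH c]])
      fix i assume i: "i \<in> I"
      note pi = is_product_proj[OF P i]
      have "\<pi> i \<odot> (counit T P \<odot> u) = counit T (A i) \<odot> (amap T (\<pi> i) \<odot> u)"
        if u: "u \<in> Hom C X (omap T P)" for u
        using Comp_assoc[OF u c pi] counit_natural[OF pi]
          Comp_assoc[OF u amap_Hom[OF pi] counit_Hom[OF A[OF i]]] by simp
      then show "\<pi> i \<odot> (counit T P \<odot> h') = \<pi> i \<odot> (counit T P \<odot> k')"
        using eq[OF i] hH kH by (simp add: h'(1) k'(1) EM_Comp)
    qed
    then have "h' = k'"
      using transpose_counit[OF X PO h'(2)] transpose_counit[OF X PO k'(2)] by metis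
    then show "h = k" by (simp add: h'(1) k'(1))
  qed
qed

text \<open>On underlying arrows this fork is split: \<open>counit T A\<close> retracts
  \<open>\<alpha>\<close>, \<open>counit T (omap T A)\<close> retracts \<open>comult T A\<close>,
  and naturality of the counit relates the two. The factorisation must moreover be a coalgebra
  morphism.\<close>

lemma coalgebra_equaliser:
  assumes A: "coalgebra C T (A, \<alpha>)"
  shows "is_equaliser (EM C T)
    (cofree T A, amap T \<alpha>, cofree T (omap T A))
    (cofree T A, comult T A, cofree T (omap T A))
    ((A, \<alpha>), \<alpha>, cofree T A)"
    (is "is_equaliser _ ?s ?t ?k")
    and "(cofree T A, amap T \<alpha>, cofree T (omap T A))
      \<in> Hom (EM C T) (cofree T A) (cofree T (omap T A))"
    and "(cofree T A, comult T A, cofree T (omap T A))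
      \<in> Hom (EM C T) (cofree T A) (cofree T (omap T A))"
proof -
  have a: "\<alpha> \<in> Hom C A (omap T A)" "counit T A \<odot> \<alpha> = Ident C A" "comult T A \<odot> \<alpha> = amap T \<alpha> \<odot> \<alpha>"
    and AO: "A \<in> Obj C"
    using A by (auto simp: coalgebra_def)
  note FA = cofree_Obj[OF AO] and FTA = cofree_Obj[OF omap_Obj[OF AO]]
  show s: "?s \<in> Hom (EM C T) (cofree T A) (cofree T (omap T A))"
    using cofree_map[OF a(1)] .
  show "?t \<in> Hom (EM C T) (cofree T A) (cofree T (omap T A))"
    using FA FTA comult_Hom[OF AO] comult_coassoc[OF AO]
    by (simp add: EM_Hom_iff EM_Obj_iff) (simp add: cofree_def coalgebra_morphism_def)
  have k: "?k \<in> Hom (EM C T) (A, \<alpha>) (cofree T A)"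
    using A FA a by (simp add: EM_Hom_iff EM_Obj_iff) (simp add: cofree_def coalgebra_morphism_def)
  have Dom: "Dom (EM C T) (X, u, Y) = X" for X u Y by (simp add: EM_def)
  have split: "counit T A \<odot> (\<alpha> \<odot> u) = u" if u: "u \<in> Hom C X A" for u X
    using Comp_assoc[OF u a(1) counit_Hom[OF AO]] a(2) Ident_Comp[OF u] by simp
  show "is_equaliser (EM C T) ?s ?t ?k"
    unfolding is_equaliser_def Dom
  proof (intro conjI allI ballI impI)
    show "?k \<in> Arr (EM C T)" "Cod (EM C T) ?k = cofree T A"
      using k by (auto simp: Hom_def)
    show "?s \<odot>\<^bsub>EM C T\<^esub> ?k = ?t \<odot>\<^bsub>EM C T\<^esub> ?k"
      using a(3) by (simp add: EM_Comp)
    fix Z h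
    assume h: "h \<in> Hom (EM C T) Z (cofree T A)" and eq: "?s \<odot>\<^bsub>EM C T\<^esub> h = ?t \<odot>\<^bsub>EM C T\<^esub> h"
    obtain X \<xi> where Zeq: "Z = (X, \<xi>)" by (cases Z)
    obtain h' where h': "h = (Z, h', cofree T A)" "coalgebra_morphism C T (X, \<xi>) (cofree T A) h'"
      and X: "coalgebra C T (X, \<xi>)"
      using h by (auto simp: EM_Hom_iff Zeq)
    have hH: "h' \<in> Hom C X (omap T A)" using h'(2) by (auto simp: cofree_def coalgebra_morphism_def)
    have eq': "amap T \<alpha> \<odot> h' = comult T A \<odot> h'" using eq by (simp add: h'(1) EM_Comp)
    \<comment> \<open>The splitting forces this choice: any factorisation of \<open>h'\<close>
      through \<open>\<alpha>\<close> is recovered by composing with the counit.\<close>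
    let ?u = "counit T A \<odot> h'"
    have u: "?u \<in> Hom C X A" using Comp_Hom[OF hH counit_Hom[OF AO]] .
    have "\<alpha> \<odot> ?u = counit T (omap T A) \<odot> (amap T \<alpha> \<odot> h')"
      using Comp_assoc[OF hH counit_Hom[OF AO] a(1)] counit_natural[OF a(1)]
        Comp_assoc[OF hH amap_Hom[OF a(1)] counit_Hom[OF omap_Obj[OF AO]]] by simp
    also have "\<dots> = h'"
      using eq' Comp_assoc[OF hH comult_Hom[OF AO] counit_Hom[OF omap_Obj[OF AO]]]
        counit_comult[OF AO] Ident_Comp[OF hH] by simp
    finally have \<alpha>u: "\<alpha> \<odot> ?u = h'" .
    \<comment> \<open>By \<open>transpose_counit\<close>, \<open>amap T ?u \<odot> \<xi>\<close> is
      \<open>h'\<close>, and so is \<open>\<alpha> \<odot> ?u\<close>.\<close>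
    then have "coalgebra_morphism C T (X, \<xi>) (A, \<alpha>) ?u"
      using u transpose_counit[OF X AO h'(2)] by (simp add: coalgebra_morphism_def)
    then have "(Z, ?u, (A, \<alpha>)) \<in> Hom (EM C T) Z (A, \<alpha>)"
      using X A by (simp add: EM_Hom_iff Zeq)
    moreover have "?k \<odot>\<^bsub>EM C T\<^esub> (Z, ?u, (A, \<alpha>)) = h" by (simp add: EM_Comp \<alpha>u h'(1))
    moreover have "v = (Z, ?u, (A, \<alpha>))"
      if v: "v \<in> Hom (EM C T) Z (A, \<alpha>)" and kv: "?k \<odot>\<^bsub>EM C T\<^esub> v = h" for v
    proof -
      obtain w where w: "v = (Z, w, (A, \<alpha>))" "w \<in> Hom C X A"
        using v by (auto simp: EM_Hom_iff Zeq coalgebra_morphism_def)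
      then have "\<alpha> \<odot> w = h'" using kv by (simp add: EM_Comp h'(1))
      then show ?thesis using split[OF w(2)] w(1) by simp
    qed
    ultimately show "\<exists>!u. u \<in> Hom (EM C T) Z (A, \<alpha>) \<and> ?k \<odot>\<^bsub>EM C T\<^esub> u = h" by blast
  qed
qed

text \<open>Each \<open>Z i\<close> is an equaliser of arrows between the cofree coalgebras on
  \<open>A i\<close> and \<open>omap T (A i)\<close>. Products of both cofree families come from the
  base category, so \<open>product_of_equalisers\<close> applies.\<close>

lemma EM_products:
  assumes prods: "has_products C I" and eqs: "has_equalisers (EM C T)"
    and Z: "\<And>i. i \<in> I \<Longrightarrow> Z i \<in> Obj (EM C T)"
  obtains K r where "is_product (EM C T) I Z K r"
proof -
  interpret EM: category "EM C T" by (rule category_EM)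
  define A \<alpha> where "A = (\<lambda>i. fst (Z i))" and "\<alpha> = (\<lambda>i. snd (Z i))"
  have Zeq: "Z i = (A i, \<alpha> i)" for i by (simp add: A_def \<alpha>_def)
  have co: "coalgebra C T (A i, \<alpha> i)" if "i \<in> I" for i
    using Z[OF that] by (simp add: EM_Obj_iff Zeq)
  then have A: "A i \<in> Obj C" and TA: "omap T (A i) \<in> Obj C" if "i \<in> I" for i
    using that omap_Obj by (auto simp: coalgebra_def)
  obtain P \<pi> where P: "is_product C I A P \<pi>"
    using prods A unfolding has_products_def by blast
  obtain Q \<rho> where Q: "is_product C I (\<lambda>i. omap T (A i)) Q \<rho>"
    using prods[unfolded has_products_def, rule_format, of "\<lambda>i. omap T (A i)"] TA by blast
  obtain K r where
    "is_product (EM C T) I (\<lambda>i. Dom (EM C T) ((A i, \<alpha> i), \<alpha> i, cofree T (A i))) K r"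
    using EM.product_of_equalisers[OF cofree_product[OF P A] cofree_product[OF Q TA]
        coalgebra_equaliser(2,3,1)[OF co] eqs] by blast
  \<comment> \<open>The sources of the equalising arrows are the coalgebras \<open>Z i\<close>
    themselves.\<close>
  then have "is_product (EM C T) I Z K r" by (simp add: EM_def Zeq[symmetric])
  then show thesis using that by blast
qed

end

section \<open>The span over the product of the apexes\<close>

theorem theorem8p6:
  fixes C :: "('o, 'a) cat"
    and T :: "('o, 'a) comonad_data"
    and E M :: "'a set"
    and Paths :: "('o \<times> 'a) set"
    and I :: "'i set"
    and A B :: "'i \<Rightarrow> 'o"
    and PA PB :: 'o
    and \<pi> \<rho> :: "'i \<Rightarrow> 'a"
  assumes "comonad C T"
    and "has_products C I"
    and "proper_factorisation_system C E M"
    and "preserves_embeddings T M"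
    and "path_category (EM C T) (lifted C T E) (lifted C T M) Paths"
    and "has_equalisers (EM C T)"
    and "closed_under_quotients (EM C T) (lifted C T E) Paths"
    and "\<And>i. i \<in> I \<Longrightarrow> A i \<in> Obj C"
    and "\<And>i. i \<in> I \<Longrightarrow> B i \<in> Obj C"
    and "is_product C I A PA \<pi>"
    and "is_product C I B PB \<rho>"
    and "\<And>i. i \<in> I \<Longrightarrow> comonad_equivalent C T M Paths (A i) (B i)"
  shows "comonad_equivalent C T M Paths PA PB"
proof -
  interpret comonad C T by fact
  interpret path_category "EM C T" "lifted C T E" "lifted C T M" Paths by fact
  let ?open = "open_arr (EM C T) (lifted C T M) Paths"
  let ?pathwise = "pathwise_embedding (EM C T) (lifted C T M) Paths"
  obtain Z f g where
    f: "\<And>i. i \<in> I \<Longrightarrow> f i \<in> Hom (EM C T) (Z i) (cofree T (A i))" and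
    g: "\<And>i. i \<in> I \<Longrightarrow> g i \<in> Hom (EM C T) (Z i) (cofree T (B i))" and
    f': "\<And>i. i \<in> I \<Longrightarrow> ?open (f i)" "\<And>i. i \<in> I \<Longrightarrow> ?pathwise (f i)" and
    g': "\<And>i. i \<in> I \<Longrightarrow> ?open (g i)" "\<And>i. i \<in> I \<Longrightarrow> ?pathwise (g i)"
  proof -
    \<comment> \<open>Membership in \<open>I\<close> sits under the existential quantifiers, so that
      choice yields total functions of \<open>i\<close>.\<close>
    have "\<forall>i. \<exists>Z f g. i \<in> I \<longrightarrow>
        f \<in> Hom (EM C T) Z (cofree T (A i)) \<and> g \<in> Hom (EM C T) Z (cofree T (B i))
        \<and> ?open f \<and> ?pathwise f \<and> ?open g \<and> ?pathwise g"
      using assms(12) unfolding comonad_equivalent_def by blast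
    then show thesis
      unfolding choice_iff using that by blast
  qed
  obtain K r where K: "is_product (EM C T) I Z K r"
    using EM_products[OF assms(2,6)] Hom_Obj(1)[OF f] by metis
  \<comment> \<open>Stated for an arbitrary family \<open>D\<close>, since both legs of the span
    arise in the same way from the common product \<open>K\<close>.\<close>
  have leg: "\<exists>h\<in>Hom (EM C T) K (cofree T P). ?open h \<and> ?pathwise h"
    if P: "is_product C I D P p" and D: "\<And>i. i \<in> I \<Longrightarrow> D i \<in> Obj C"
      and k: "\<And>i. i \<in> I \<Longrightarrow> k i \<in> Hom (EM C T) (Z i) (cofree T (D i))"
      and k': "\<And>i. i \<in> I \<Longrightarrow> ?open (k i)" "\<And>i. i \<in> I \<Longrightarrow> ?pathwise (k i)"
    for D P p k
  proof -
    note FP = cofree_product[OF P D]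
    obtain h where h: "h \<in> Hom (EM C T) K (cofree T P)"
      "\<And>i. i \<in> I \<Longrightarrow> (cofree T P, amap T (p i), cofree T (D i)) \<odot>\<^bsub>EM C T\<^esub> h = k i \<odot>\<^bsub>EM C T\<^esub> r i"
      using product_map[OF K FP k] by blast
    show ?thesis
      using product_open[OF assms(7) K FP k k'(2) h k'(1)]
        product_pathwise_embedding[OF assms(7) K FP k k'(2) h] h(1) by blast
  qed
  show ?thesis
    using leg[OF assms(10,8) f f'] leg[OF assms(11,9) g g'] unfolding comonad_equivalent_def by blast
qed

end
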